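(* Let $\mathcal A$ and $\mathcal B$ be ideals of closed subsets of a space $X$ and suppose that $X$ is $\mathcal A$-normal. Then $$\mathcal G := \mathsf G_1(\mathcal O_X(\mathcal A), \mathcal O_X(\mathcal B)) \equiv \mathsf G_1(\Omega_{\mathrm{MC}_{\mathcal A}(X),\mathbf 0},\Omega_{\mathrm{MC}_{\mathcal B}(X),\mathbf 0}) \equiv \mathsf G_1(\mathscr D_{\mathrm{MC}_{\mathcal A}(X)},\Omega_{\mathrm{MC}_{\mathcal B}(X),\mathbf 0}),$$ $$\mathcal H := \mathsf G_1(\mathscr N_X[\mathcal A], \neg \mathcal O_X(\mathcal B)) \equiv \mathsf G_1(\mathscr N_{\mathrm{MC}_{\mathcal A}(X),\mathbf 0}, \neg \Omega_{\mathrm{MC}_{\mathcal B}(X),\mathbf 0}) \equiv \mathsf G_1(\mathscr T_{\mathrm{MC}_{\mathcal A}(X)}, \neg \Omega_{\mathrm{MC}_{\mathcal B}(X),\mathbf 0}),$$ and $\mathcal G$ is dual to $\mathcal H$.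
   Context: Spaces and ideals. All spaces are Hausdorff. An ideal of closed sets of $X$ is a family $\mathcal A$ of non-empty closed subsets of $X$ such that $A\cup B\in\mathcal A$ for $A,B\in\mathcal A$; every non-empty closed subset of a member of $\mathcal A$ is in $\mathcal A$; and $\{x\}\in\mathcal A$ for every $x\in X$. Every ideal of closed sets is assumed not to contain $X$ itself. $X$ is $\mathcal A$-normal if for all $A\in\mathcal A$ and open $U\supseteq A$ there is an open $V$ with $A\subseteq V\subseteq \mathrm{cl}(V)\subseteq U$. Minimal cusco maps. A cusco map $\Phi$ from $X$ to $\mathbb R$ assigns to each $x\in X$ a non-empty compact convex set $\Phi(x)\subseteq\mathbb R$ and is upper semicontinuous: $\{x\in X:\Phi(x)\subseteq V\}$ is open for every open $V\subseteq\mathbb R$. It is minimal if its graph $\{\langle x,y\rangle:y\in\Phi(x)\}$ is $\subseteq$-minimal among graphs of cusco maps from $X$ to $\mathbb R$. $\mathrm{MC}(X)$ is the set of all minimal cusco maps from $X$ to $\mathbb R$; $\mathbf 0\in \mathrm{MC}(X)$ is the map constantly $\{0\}$. For $A\subseteq X$ and $\varepsilon>0$, $\mathbf W(A,\varepsilon)$ is the set of pairs $\langle\Phi,\Psi\rangle$ such that for all $x\in A$, $\Phi(x)\subseteq\bigcup_{y\in\Psi(x)}B(y,\varepsilon)$ and $\Psi(x)\subseteq\bigcup_{y\in\Phi(x)}B(y,\varepsilon)$, where $B(y,\varepsilon)=(y-\varepsilon,y+\varepsilon)$. $\mathrm{MC}_{\mathcal A}(X)$ is $\mathrm{MC}(X)$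 with the topology generated by the uniformity with base $\{\mathbf W(A,\varepsilon):A\in\mathcal A,\varepsilon>0\}$. Collections. An $\mathcal A$-cover of $X$ is an open cover $\mathscr U$ of $X$ with $\emptyset\notin\mathscr U$, $X\notin\mathscr U$ such that every $A\in\mathcal A$ is contained in some $U\in\mathscr U$. $\mathcal O_X(\mathcal A)$ is the set of all $\mathcal A$-covers. For a space $Y$ and $y\in Y$: $\mathscr T_Y$ is the set of all proper non-empty open subsets of $Y$; $\mathscr N_{Y,y}=\{U\in\mathscr T_Y:y\in U\}$; $\mathscr N_Y(A)=\{U\in\mathscr T_Y:A\subseteq U\}$ for $A\subseteq Y$, and $\mathscr N_Y[\mathcal A]=\{\mathscr N_Y(A):A\in\mathcal A\}$; $\Omega_{Y,y}=\{A\subseteq Y:y\in\mathrm{cl}_Y(A)\}$; $\mathscr D_Y$ is the set of dense subsets of $Y$. $\neg\mathcal D$ is the collection of sets not in $\mathcal D$. Games. In $\mathsf G_1(\mathcal C,\mathcal D)$, in inning $n\in\omega$ One plays $A_n\in\mathcal C$ and Two responds with $x_n\in A_n$; Two wins if $\{x_n:n\in\omega\}\in\mathcal D$, otherwise One wins. $\mathrm I\uparrow\mathcal G$ (resp. $\mathrm{II}\uparrow\mathcal G$): One (resp. Two) has a winning strategy, where strategies may depend on all previous moves of the opponent (for Two, including the current one). $\mathrm I\uparrow_{\mathrm{pre}}\mathcal G$: One has a winning predetermined strategy, i.e. one depending only on $n$. $\mathrm{II}\uparrow_{\mathrm{mark}}\mathcal G$: Two has a winning Markov strategy, i.e. one depending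 only on One's current move and $n$. $\mathcal G\equiv\mathcal H$ (equivalent) means that each of $\mathrm{II}\uparrow_{\mathrm{mark}}$, $\mathrm{II}\uparrow$, $\mathrm I\uparrow$, $\mathrm I\uparrow_{\mathrm{pre}}$ holds for $\mathcal G$ if and only if it holds for $\mathcal H$. $\mathcal G$ is dual to $\mathcal H$ if $\mathrm I\uparrow\mathcal G\Leftrightarrow\mathrm{II}\uparrow\mathcal H$, $\mathrm{II}\uparrow\mathcal G\Leftrightarrow\mathrm I\uparrow\mathcal H$, $\mathrm I\uparrow_{\mathrm{pre}}\mathcal G\Leftrightarrow\mathrm{II}\uparrow_{\mathrm{mark}}\mathcal H$, and $\mathrm{II}\uparrow_{\mathrm{mark}}\mathcal G\Leftrightarrow\mathrm I\uparrow_{\mathrm{pre}}\mathcal H$. *)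

theory Defs
  imports "HOL-Analysis.Analysis"
begin

section \<open>Ideals of closed sets and covers\<close>

text \<open>The base space is a type of class \<open>topological_space\<close> (later \<open>t2_space\<close>), with the whole
  type as its underlying set. The spaces of set-valued maps carry several topologies at once,
  so they are values of type \<open>topology\<close>.\<close>

definition closed_ideal :: "'a::topological_space set set \<Rightarrow> bool" where
  "closed_ideal \<A> \<longleftrightarrow>
     (\<forall>A\<in>\<A>. closed A \<and> A \<noteq> {}) \<and>
     (\<forall>A\<in>\<A>. \<forall>B\<in>\<A>. A \<union> B \<in> \<A>) \<and>
     (\<forall>A\<in>\<A>. \<forall>C. closed C \<and> C \<noteq> {} \<and> C \<subseteq> A \<longrightarrow> C \<in> \<A>) \<and>
     (\<forall>x. {x} \<in> \<A>) \<and>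
     UNIV \<notin> \<A>"

definition ideal_normal :: "'a::topological_space set set \<Rightarrow> bool" where
  "ideal_normal \<A> \<longleftrightarrow>
     (\<forall>A\<in>\<A>. \<forall>U. open U \<and> A \<subseteq> U \<longrightarrow>
        (\<exists>V. open V \<and> A \<subseteq> V \<and> V \<subseteq> closure V \<and> closure V \<subseteq> U))"

definition ideal_covers :: "'a::topological_space set set \<Rightarrow> 'a set set set" where
  "ideal_covers \<A> =
     {\<U>. (\<forall>U\<in>\<U>. open U) \<and> \<Union>\<U> = UNIV \<and> {} \<notin> \<U> \<and> UNIV \<notin> \<U> \<and>
          (\<forall>A\<in>\<A>. \<exists>U\<in>\<U>. A \<subseteq> U)}"


section \<open>Collections attached to a topological space\<close>

definition proper_opens :: "'b topology \<Rightarrow> 'b set set" where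
  "proper_opens Y = {U. openin Y U \<and> U \<noteq> {} \<and> U \<noteq> topspace Y}"

definition point_nbhds :: "'b topology \<Rightarrow> 'b \<Rightarrow> 'b set set" where
  "point_nbhds Y y = {U \<in> proper_opens Y. y \<in> U}"

definition set_nbhds :: "'b topology \<Rightarrow> 'b set \<Rightarrow> 'b set set" where
  "set_nbhds Y A = {U \<in> proper_opens Y. A \<subseteq> U}"

definition clustering_sets :: "'b topology \<Rightarrow> 'b \<Rightarrow> 'b set set" where
  "clustering_sets Y y = {A. A \<subseteq> topspace Y \<and> y \<in> Y closure_of A}"

definition dense_sets :: "'b topology \<Rightarrow> 'b set set" where
  "dense_sets Y = {A. A \<subseteq> topspace Y \<and> Y closure_of A = topspace Y}"


section \<open>The topology of a uniformity\<close>

text \<open>For a uniformity \<open>F\<close> on a set \<open>S\<close>, given as a filter on pairs; this is the condition by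
  which the class \<open>uniform_space\<close> ties its open sets to its uniformity.\<close>

definition uniform_topology :: "'b set \<Rightarrow> ('b \<times> 'b) filter \<Rightarrow> 'b topology" where
  "uniform_topology S F =
     topology (\<lambda>U. U \<subseteq> S \<and> (\<forall>x\<in>U. eventually (\<lambda>(x', y). x' = x \<longrightarrow> y \<in> U) F))"

lemma openin_uniform_topology:
  "openin (uniform_topology S F) U \<longleftrightarrow>
     U \<subseteq> S \<and> (\<forall>x\<in>U. eventually (\<lambda>(x', y). x' = x \<longrightarrow> y \<in> U) F)"
proof -
  let ?P = "\<lambda>U. U \<subseteq> S \<and> (\<forall>x\<in>U. eventually (\<lambda>(x', y). x' = x \<longrightarrow> y \<in> U) F)"
  have "istopology ?P"
    unfolding istopology_def
  proof (intro conjI allI impI ballI)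
    fix U V x assume U: "?P U" and V: "?P V" and x: "x \<in> U \<inter> V"
    have "eventually (\<lambda>(x', y). x' = x \<longrightarrow> y \<in> U) F" "eventually (\<lambda>(x', y). x' = x \<longrightarrow> y \<in> V) F"
      using U V x by auto
    then show "eventually (\<lambda>(x', y). x' = x \<longrightarrow> y \<in> U \<inter> V) F"
      by eventually_elim auto
  next
    fix \<K> x assume K: "\<forall>U\<in>\<K>. ?P U" and "x \<in> \<Union>\<K>"
    then obtain U where U: "U \<in> \<K>" "x \<in> U" by blast
    with K have "eventually (\<lambda>(x', y). x' = x \<longrightarrow> y \<in> U) F" by blast
    then show "eventually (\<lambda>(x', y). x' = x \<longrightarrow> y \<in> \<Union>\<K>) F"
      by eventually_elim (use U in auto)
  qed auto
  then show ?thesis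
    unfolding uniform_topology_def by (simp add: topology_inverse')
qed


section \<open>Minimal cusco maps\<close>

definition cusco :: "('a::topological_space \<Rightarrow> real set) \<Rightarrow> bool" where
  "cusco \<Phi> \<longleftrightarrow>
     (\<forall>x. \<Phi> x \<noteq> {} \<and> compact (\<Phi> x) \<and> convex (\<Phi> x)) \<and>
     (\<forall>V. open V \<longrightarrow> open {x. \<Phi> x \<subseteq> V})"

definition map_graph :: "('a \<Rightarrow> 'b set) \<Rightarrow> ('a \<times> 'b) set" where
  "map_graph \<Phi> = {(x, y). y \<in> \<Phi> x}"

definition minimal_cusco :: "('a::topological_space \<Rightarrow> real set) set" where
  "minimal_cusco =
     {\<Phi>. cusco \<Phi> \<and>
          (\<forall>\<Psi>. cusco \<Psi> \<and> map_graph \<Psi> \<subseteq> map_graph \<Phi> \<longrightarrow> map_graph \<Psi> = map_graph \<Phi>)}"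

definition zero_map :: "'a \<Rightarrow> real set" where
  "zero_map = (\<lambda>x. {0})"

definition mc_entourage ::
    "'a set \<Rightarrow> real \<Rightarrow> (('a::topological_space \<Rightarrow> real set) \<times> ('a \<Rightarrow> real set)) set" where
  "mc_entourage A \<epsilon> =
     {(\<Phi>, \<Psi>). \<Phi> \<in> minimal_cusco \<and> \<Psi> \<in> minimal_cusco \<and>
        (\<forall>x\<in>A. \<Phi> x \<subseteq> (\<Union>y\<in>\<Psi> x. ball y \<epsilon>) \<and> \<Psi> x \<subseteq> (\<Union>y\<in>\<Phi> x. ball y \<epsilon>))}"

definition mc_uniformity ::
    "'a set set \<Rightarrow> (('a::topological_space \<Rightarrow> real set) \<times> ('a \<Rightarrow> real set)) filter" where
  "mc_uniformity \<A> = (INF (A, \<epsilon>)\<in>\<A> \<times> {0<..}. principal (mc_entourage A \<epsilon>))"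

definition mc_space :: "'a::topological_space set set \<Rightarrow> ('a \<Rightarrow> real set) topology" where
  "mc_space \<A> = uniform_topology minimal_cusco (mc_uniformity \<A>)"

lemma zero_map_minimal_cusco: "zero_map \<in> minimal_cusco"
proof -
  have "cusco (zero_map :: 'a \<Rightarrow> real set)"
    by (auto simp: cusco_def zero_map_def)
  moreover have "map_graph \<Psi> = map_graph zero_map"
    if "cusco \<Psi>" "map_graph \<Psi> \<subseteq> map_graph zero_map" for \<Psi> :: "'a \<Rightarrow> real set"
  proof -
    have "\<Psi> x = {0}" for x
      using that by (force simp: cusco_def map_graph_def zero_map_def)
    then show ?thesis by (simp add: map_graph_def zero_map_def)
  qed
  ultimately show ?thesis by (auto simp: minimal_cusco_def)
qed

lemma mc_entourage_mono:
  "A \<subseteq> A' \<Longrightarrow> \<epsilon>' \<le> \<epsilon> \<Longrightarrow> mc_entourage A' \<epsilon>' \<subseteq> mc_entourage A \<epsilon>"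
proof -
  assume "A \<subseteq> A'" "\<epsilon>' \<le> \<epsilon>"
  moreover from this(2) have "(\<Union>y\<in>Y. ball y \<epsilon>') \<subseteq> (\<Union>y\<in>Y. ball y \<epsilon>)" for Y :: "real set"
    by (intro UN_mono) (auto simp: subset_ball)
  ultimately show ?thesis
    unfolding mc_entourage_def by (blast intro: order_trans)
qed

text \<open>For an ideal the entourages form a filter base, not merely a subbase.\<close>

lemma eventually_mc_uniformity:
  assumes "closed_ideal \<A>"
  shows "eventually P (mc_uniformity \<A>) \<longleftrightarrow> (\<exists>A\<in>\<A>. \<exists>\<epsilon>>0. \<forall>p\<in>mc_entourage A \<epsilon>. P p)"
proof -
  have "\<A> \<noteq> {}" using assms unfolding closed_ideal_def by blast
  moreover have "\<exists>r\<in>\<A> \<times> {0<..}.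
      principal (case r of (A, \<epsilon>) \<Rightarrow> mc_entourage A \<epsilon>) \<le>
      inf (principal (case p of (A, \<epsilon>) \<Rightarrow> mc_entourage A \<epsilon>))
          (principal (case q of (A, \<epsilon>) \<Rightarrow> mc_entourage A \<epsilon>))"
    if p: "p \<in> \<A> \<times> {0<..}" and q: "q \<in> \<A> \<times> {0<..}" for p q
  proof -
    obtain A a B b where [simp]: "p = (A, a)" "q = (B, b)" by (cases p, cases q) auto
    have "(A \<union> B, min a b) \<in> \<A> \<times> {0<..}"
      using p q assms by (auto simp: closed_ideal_def)
    moreover have "mc_entourage (A \<union> B) (min a b) \<subseteq> mc_entourage A a \<inter> mc_entourage B b"
      using mc_entourage_mono[of A "A \<union> B" "min a b" a]
            mc_entourage_mono[of B "A \<union> B" "min a b" b] by auto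
    ultimately show ?thesis by (intro bexI[of _ "(A \<union> B, min a b)"]) auto
  qed
  ultimately have "eventually P (INF p\<in>\<A> \<times> {0<..}. principal (case p of (A, \<epsilon>) \<Rightarrow> mc_entourage A \<epsilon>))
      \<longleftrightarrow> (\<exists>p\<in>\<A> \<times> {0<..}. eventually P (principal (case p of (A, \<epsilon>) \<Rightarrow> mc_entourage A \<epsilon>)))"
    by (intro eventually_INF_base) (auto intro: exI[of _ "1::real"])
  then show ?thesis
    by (auto simp: mc_uniformity_def eventually_principal case_prod_unfold)
qed

lemma openin_mc_space:
  assumes "closed_ideal \<A>"
  shows "openin (mc_space \<A>) U \<longleftrightarrow>
    U \<subseteq> minimal_cusco \<and> (\<forall>\<Phi>\<in>U. \<exists>A\<in>\<A>. \<exists>\<epsilon>>0. mc_entourage A \<epsilon> `` {\<Phi>} \<subseteq> U)"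
proof -
  have "(\<forall>p\<in>E. case p of (\<Phi>', \<Psi>) \<Rightarrow> \<Phi>' = \<Phi> \<longrightarrow> \<Psi> \<in> U) \<longleftrightarrow> E `` {\<Phi>} \<subseteq> U"
    for E :: "(('a \<Rightarrow> real set) \<times> ('a \<Rightarrow> real set)) set" and \<Phi>
    by auto
  then show ?thesis
    by (simp only: mc_space_def openin_uniform_topology eventually_mc_uniformity[OF assms])
qed

lemma topspace_mc_space:
  assumes "closed_ideal \<A>"
  shows "topspace (mc_space \<A>) = minimal_cusco"
proof -
  obtain A where "A \<in> \<A>" using assms unfolding closed_ideal_def by blast
  then have "openin (mc_space \<A>) minimal_cusco"
    unfolding openin_mc_space[OF assms]
    by (auto simp: mc_entourage_def intro!: bexI[of _ A] exI[of _ "1::real"])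
  then show ?thesis
    using openin_mc_space[OF assms, of "topspace (mc_space \<A>)"] openin_subset by blast
qed


section \<open>Selection games\<close>

datatype 'm game = G1 (one_moves: "'m set set") (two_goal: "'m set set")

text \<open>A strategy for One sees the list of Two's earlier moves.\<close>

definition one_wins :: "'m game \<Rightarrow> bool" where
  "one_wins G \<longleftrightarrow>
     (\<exists>\<sigma>. (\<forall>xs\<in>lists (\<Union>(one_moves G)). \<sigma> xs \<in> one_moves G) \<and>
          (\<forall>x::nat \<Rightarrow> 'm. (\<forall>n. x n \<in> \<sigma> (map x [0..<n])) \<longrightarrow> range x \<notin> two_goal G))"

text \<open>A strategy for Two sees the non-empty list of One's moves up to and including the current one.\<close>

definition two_wins :: "'m game \<Rightarrow> bool" where
  "two_wins G \<longleftrightarrow>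
     (\<exists>\<tau>. (\<forall>As\<in>lists (one_moves G). As \<noteq> [] \<longrightarrow> \<tau> As \<in> last As) \<and>
          (\<forall>A::nat \<Rightarrow> 'm set. (\<forall>n. A n \<in> one_moves G) \<longrightarrow>
              range (\<lambda>n. \<tau> (map A [0..<Suc n])) \<in> two_goal G))"

definition one_wins_pre :: "'m game \<Rightarrow> bool" where
  "one_wins_pre G \<longleftrightarrow>
     (\<exists>\<sigma>::nat \<Rightarrow> 'm set. (\<forall>n. \<sigma> n \<in> one_moves G) \<and>
          (\<forall>x. (\<forall>n. x n \<in> \<sigma> n) \<longrightarrow> range x \<notin> two_goal G))"

definition two_wins_mark :: "'m game \<Rightarrow> bool" where
  "two_wins_mark G \<longleftrightarrow>
     (\<exists>\<tau>::'m set \<Rightarrow> nat \<Rightarrow> 'm. (\<forall>A\<in>one_moves G. \<forall>n. \<tau> A n \<in> A) \<and>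
          (\<forall>A. (\<forall>n. A n \<in> one_moves G) \<longrightarrow> range (\<lambda>n. \<tau> (A n) n) \<in> two_goal G))"

definition equivalent_games :: "'m game \<Rightarrow> 'n game \<Rightarrow> bool" where
  "equivalent_games G H \<longleftrightarrow>
     (two_wins_mark G \<longleftrightarrow> two_wins_mark H) \<and>
     (two_wins G \<longleftrightarrow> two_wins H) \<and>
     (one_wins G \<longleftrightarrow> one_wins H) \<and>
     (one_wins_pre G \<longleftrightarrow> one_wins_pre H)"

definition dual_games :: "'m game \<Rightarrow> 'n game \<Rightarrow> bool" where
  "dual_games G H \<longleftrightarrow>
     (one_wins G \<longleftrightarrow> two_wins H) \<and>
     (two_wins G \<longleftrightarrow> one_wins H) \<and>
     (one_wins_pre G \<longleftrightarrow> two_wins_mark H) \<and>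
     (two_wins_mark G \<longleftrightarrow> one_wins_pre H)"

end

theory Submission
  imports Defs
begin

text \<open>Three games in which One plays covers, sets clustering at zero, or dense sets are compared in
  a cycle; the statements about the other three games then follow by duality.

  Two can play the clustering game by way of the cover game: in inning \<open>n\<close> a set of maps
  clustering at \<open>\<zero>\<close> is read as the cover by the sets where one of its maps is smaller than
  \<open>1 / (n + 1)\<close>, and these form a cover in the required sense because the maps are upper
  semicontinuous (\<open>clustering_game_no_harder_than_cover_game\<close>). A dense set clusters everywhere, so
  One has fewer moves in the dense set game than in the clustering game. Finally Two can play
  the cover game by way of the dense set game, reading a cover \<open>\<U>\<close> as the set of those minimal cusco
  maps that are constantly \<open>1\<close> off some member of \<open>\<U>\<close>
  (\<open>cover_game_no_harder_than_dense_game\<close>). Density of this set is the topological core: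
  normality gives room around a member of the ideal on which a given map is kept, the map is
  overwritten by the constant further away, and Zorn's lemma selects a minimal cusco map from the
  outcome (\<open>minimal_cusco_patch_constant\<close>).

  Each of the three games is dual to a game in which One plays respectively the set of open
  neighbourhoods of a member of the ideal, a neighbourhood of \<open>\<zero>\<close>, or an open set. In all
  three cases the reason is the same:
  choosing one element from each move of One in this second game yields a move of One in the first,
  and every move of One in the first game meets every move of One in the second (\<open>dual_games_if_dual_families\<close>).\<close>


section \<open>Replaying a run of one game inside another\<close>

text \<open>A strategy for one game is turned into a strategy for another by maintaining, next to
  the observed moves, the moves of an imaginary run of the other game. The next imaginary move
  depends on all earlier imaginary moves and on the newly observed one.\<close>

definition replay :: "('y list \<Rightarrow> 'x \<Rightarrow> 'y) \<Rightarrow> 'x list \<Rightarrow> 'y list" where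
  "replay step xs = fold (\<lambda>x ys. ys @ [step ys x]) xs []"

lemma replay_Nil [simp]: "replay step [] = []"
  by (simp add: replay_def)

lemma replay_snoc [simp]:
  "replay step (xs @ [x]) = replay step xs @ [step (replay step xs) x]"
  by (simp add: replay_def)

lemma length_replay [simp]: "length (replay step xs) = length xs"
  by (induction xs rule: rev_induct) auto

lemma replay_run:
  "replay step (map x [0..<n]) = map (\<lambda>k. step (replay step (map x [0..<k])) (x k)) [0..<n]"
  by (induction n) auto


text \<open>One never has to answer positions that his own strategy cannot reach, so it suffices to
  prescribe legal moves along legal plays.\<close>

definition legal_play :: "('m list \<Rightarrow> 'm set) \<Rightarrow> 'm list \<Rightarrow> bool" where
  "legal_play \<sigma> xs \<longleftrightarrow> (\<forall>i<length xs. xs ! i \<in> \<sigma> (take i xs))"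

lemma legal_play_Nil [simp]: "legal_play \<sigma> []"
  by (simp add: legal_play_def)

lemma legal_play_snoc [simp]:
  "legal_play \<sigma> (xs @ [x]) \<longleftrightarrow> legal_play \<sigma> xs \<and> x \<in> \<sigma> xs"
  by (auto simp: legal_play_def nth_append less_Suc_eq)

lemma one_wins_by_legal_plays:
  assumes moves: "\<And>xs. legal_play \<sigma> xs \<Longrightarrow> \<sigma> xs \<in> one_moves G"
    and wins: "\<And>x. (\<And>n. x n \<in> \<sigma> (map x [0..<n])) \<Longrightarrow> range x \<notin> two_goal G"
  shows "one_wins G"
proof -
  let ?\<sigma> = "\<lambda>xs. if legal_play \<sigma> xs then \<sigma> xs else \<sigma> []"
  have "range x \<notin> two_goal G" if x: "\<forall>n. x n \<in> ?\<sigma> (map x [0..<n])" for x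
  proof (rule wins)
    have legal: "legal_play \<sigma> (map x [0..<n])" for n
    proof (induction n)
      case (Suc n)
      then show ?case using spec[OF x, of n] by simp
    qed simp
    show "x n \<in> \<sigma> (map x [0..<n])" for n
      using spec[OF x, of n] legal[of n] by simp
  qed
  then show ?thesis
    unfolding one_wins_def using moves by (intro exI[of _ ?\<sigma>]) auto
qed


section \<open>Comparing games from the side of Two\<close>

definition no_harder_for_two :: "'m game \<Rightarrow> 'n game \<Rightarrow> bool" where
  "no_harder_for_two H G \<longleftrightarrow>
     (two_wins_mark G \<longrightarrow> two_wins_mark H) \<and>
     (two_wins G \<longrightarrow> two_wins H) \<and>
     (one_wins H \<longrightarrow> one_wins G) \<and>
     (one_wins_pre H \<longrightarrow> one_wins_pre G)"

lemma equivalent_games_if_cycle: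
  assumes "no_harder_for_two H G" "no_harder_for_two K H" "no_harder_for_two G K"
  shows "equivalent_games G H" "equivalent_games H K"
  using assms unfolding no_harder_for_two_def equivalent_games_def by argo+

text \<open>Two plays \<open>H\<close> by pretending to play \<open>G\<close>: a move of One in \<open>H\<close> is translated into a move
  of One in \<open>G\<close>, and Two's answer in \<open>G\<close> is translated back. One uses the same dictionary in the
  opposite direction to carry a winning strategy from \<open>H\<close> to \<open>G\<close>.\<close>

lemma no_harder_for_two_by_translation:
  fixes TI :: "nat \<Rightarrow> 'n set \<Rightarrow> 'm set" and TII :: "nat \<Rightarrow> 'n set \<Rightarrow> 'm \<Rightarrow> 'n"
  assumes TI: "\<And>n B. B \<in> one_moves H \<Longrightarrow> TI n B \<in> one_moves G"
    and TII: "\<And>n B x. B \<in> one_moves H \<Longrightarrow> x \<in> TI n B \<Longrightarrow> TII n B x \<in> B"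
    and goal: "\<And>B x. (\<And>n. B n \<in> one_moves H) \<Longrightarrow> (\<And>n. x n \<in> TI n (B n)) \<Longrightarrow>
      range x \<in> two_goal G \<Longrightarrow> range (\<lambda>n. TII n (B n) (x n)) \<in> two_goal H"
  shows "no_harder_for_two H G"
  unfolding no_harder_for_two_def
proof (intro conjI impI)
  assume "two_wins_mark G"
  then obtain \<tau> :: "'m set \<Rightarrow> nat \<Rightarrow> 'm" where \<tau>: "\<forall>A\<in>one_moves G. \<forall>n. \<tau> A n \<in> A"
    and win [rule_format]: "\<forall>A. (\<forall>n. A n \<in> one_moves G) \<longrightarrow> range (\<lambda>n. \<tau> (A n) n) \<in> two_goal G"
    unfolding two_wins_mark_def by blast
  have "range (\<lambda>n. TII n (B n) (\<tau> (TI n (B n)) n)) \<in> two_goal H"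
    if "\<forall>n. B n \<in> one_moves H" for B
  proof (rule goal)
    show "B n \<in> one_moves H" for n using that by simp
    then show "\<tau> (TI n (B n)) n \<in> TI n (B n)" for n using \<tau> TI by blast
    show "range (\<lambda>n. \<tau> (TI n (B n)) n) \<in> two_goal G"
      by (rule win) (use that TI in blast)
  qed
  moreover have "TII n B (\<tau> (TI n B) n) \<in> B" if "B \<in> one_moves H" for n B
    using TII TI \<tau> that by blast
  ultimately show "two_wins_mark H"
    unfolding two_wins_mark_def by (intro exI[of _ "\<lambda>B n. TII n B (\<tau> (TI n B) n)"]) blast
next
  assume "two_wins G"
  then obtain \<tau> where \<tau>: "\<forall>As\<in>lists (one_moves G). As \<noteq> [] \<longrightarrow> \<tau> As \<in> last As"
    and win [rule_format]: "\<forall>A. (\<forall>n. A n \<in> one_moves G) \<longrightarrow>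
      range (\<lambda>n. \<tau> (map A [0..<Suc n])) \<in> two_goal G"
    unfolding two_wins_def by blast
  define tr where "tr = replay (\<lambda>As B. TI (length As) B)"
  have tr_snoc: "tr (Bs @ [B]) = tr Bs @ [TI (length Bs) B]" for Bs B
    by (simp add: tr_def)
  have tr_run: "tr (map B [0..<n]) = map (\<lambda>k. TI k (B k)) [0..<n]" for B n
    unfolding tr_def by (subst replay_run) simp
  have tr_lists: "tr Bs \<in> lists (one_moves G)" if "Bs \<in> lists (one_moves H)" for Bs
    using that by (induction Bs rule: rev_induct) (auto simp: tr_def TI)
  define \<tau>' where "\<tau>' Bs = TII (length Bs - 1) (last Bs) (\<tau> (tr Bs))" for Bs
  have resp: "\<tau> (tr (Bs @ [B])) \<in> TI (length Bs) B" if "Bs @ [B] \<in> lists (one_moves H)" for Bs B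
    using bspec[OF \<tau> tr_lists[OF that]] by (simp add: tr_snoc)
  have "\<tau>' Bs \<in> last Bs" if "Bs \<in> lists (one_moves H)" "Bs \<noteq> []" for Bs
  proof -
    obtain Cs B where Bs: "Bs = Cs @ [B]" using \<open>Bs \<noteq> []\<close> by (cases Bs rule: rev_cases) auto
    show ?thesis using resp[of Cs B] that by (auto simp: \<tau>'_def Bs intro!: TII)
  qed
  moreover have "range (\<lambda>n. \<tau>' (map B [0..<Suc n])) \<in> two_goal H"
    if B: "\<forall>n. B n \<in> one_moves H" for B
  proof -
    have "range (\<lambda>n. TII n (B n) (\<tau> (tr (map B [0..<Suc n])))) \<in> two_goal H"
    proof (rule goal)
      show "B n \<in> one_moves H" for n using B by simp
      show "\<tau> (tr (map B [0..<Suc n])) \<in> TI n (B n)" for n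
        using resp[of "map B [0..<n]" "B n"] B by (auto simp: in_lists_conv_set)
      show "range (\<lambda>n. \<tau> (tr (map B [0..<Suc n]))) \<in> two_goal G"
        unfolding tr_run by (rule win) (use B TI in auto)
    qed
    then show ?thesis by (simp add: \<tau>'_def)
  qed
  ultimately show "two_wins H" unfolding two_wins_def by blast
next
  assume "one_wins H"
  then obtain \<sigma> where \<sigma>: "\<forall>ys\<in>lists (\<Union>(one_moves H)). \<sigma> ys \<in> one_moves H"
    and win [rule_format]: "\<forall>y. (\<forall>n. y n \<in> \<sigma> (map y [0..<n])) \<longrightarrow> range y \<notin> two_goal H"
    unfolding one_wins_def by blast
  define tr where "tr = replay (\<lambda>ys x. TII (length ys) (\<sigma> ys) x)"
  define \<sigma>' where "\<sigma>' xs = TI (length xs) (\<sigma> (tr xs))" for xs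
  have tr_snoc: "tr (xs @ [x]) = tr xs @ [TII (length xs) (\<sigma> (tr xs)) x]" for xs x
    by (simp add: tr_def)
  have tr_legal: "tr xs \<in> lists (\<Union>(one_moves H))" if "legal_play \<sigma>' xs" for xs
    using that
  proof (induction xs rule: rev_induct)
    case (snoc x xs)
    then have "\<sigma> (tr xs) \<in> one_moves H" using \<sigma> by auto
    moreover from this have "TII (length xs) (\<sigma> (tr xs)) x \<in> \<sigma> (tr xs)"
      using snoc.prems by (intro TII) (auto simp: \<sigma>'_def)
    ultimately show ?case using snoc by (auto simp: tr_snoc)
  qed (simp add: tr_def)
  show "one_wins G"
  proof (rule one_wins_by_legal_plays)
    show "\<sigma>' xs \<in> one_moves G" if "legal_play \<sigma>' xs" for xs
      unfolding \<sigma>'_def using TI \<sigma> tr_legal[OF that] by blast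
  next
    fix x assume x: "\<And>n. x n \<in> \<sigma>' (map x [0..<n])"
    have legal: "legal_play \<sigma>' (map x [0..<n])" for n
      by (induction n) (use x in auto)
    define B where "B n = \<sigma> (tr (map x [0..<n]))" for n
    have B: "B n \<in> one_moves H" for n
      unfolding B_def using \<sigma> tr_legal[OF legal] by blast
    have xB: "x n \<in> TI n (B n)" for n using x[of n] by (simp add: \<sigma>'_def B_def)
    define y where "y n = TII n (B n) (x n)" for n
    have "tr (map x [0..<n]) = map y [0..<n]" for n
      by (induction n) (simp_all add: tr_snoc y_def B_def, simp add: tr_def)
    then have "y n \<in> \<sigma> (map y [0..<n])" for n
      using TII[OF B xB, of n] by (simp add: y_def B_def)
    then have "range y \<notin> two_goal H" using win by blast
    then show "range x \<notin> two_goal G" using goal[of B x] B xB by (auto simp: y_def)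
  qed
next
  assume "one_wins_pre H"
  then obtain \<sigma> :: "nat \<Rightarrow> 'n set" where \<sigma>: "\<And>n. \<sigma> n \<in> one_moves H"
    and win [rule_format]: "\<forall>y. (\<forall>n. y n \<in> \<sigma> n) \<longrightarrow> range y \<notin> two_goal H"
    unfolding one_wins_pre_def by blast
  have "range x \<notin> two_goal G" if "\<forall>n. x n \<in> TI n (\<sigma> n)" for x
    using goal[of \<sigma> x] win[of "\<lambda>n. TII n (\<sigma> n) (x n)"] \<sigma> TII that by blast
  then show "one_wins_pre G"
    unfolding one_wins_pre_def by (intro exI[of _ "\<lambda>n. TI n (\<sigma> n)"]) (simp add: TI \<sigma>)
qed

lemma no_harder_for_two_if_fewer_moves:
  assumes "P \<subseteq> Q"
  shows "no_harder_for_two (G1 P D) (G1 Q D)"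
proof (rule no_harder_for_two_by_translation[where TI = "\<lambda>_ B. B" and TII = "\<lambda>_ _ x. x"])
  show "B \<in> one_moves (G1 Q D)" if "B \<in> one_moves (G1 P D)" for B
    using assms that by auto
qed simp_all


section \<open>Duality\<close>

text \<open>The motivating example: \<open>P\<close> consists of the sets clustering at a point and \<open>Q\<close> of the
  neighbourhoods of that point. Absorption of the choice functions on \<open>Q\<close> is what allows One,
  who plays members of \<open>P\<close>, to anticipate every answer that a strategy for Two gives to a
  member of \<open>Q\<close>. Stating it for inclusion, and not for equality with a member of \<open>P\<close>, makes
  duality of families a symmetric relation.\<close>

definition meeting :: "'m set set \<Rightarrow> 'm set set \<Rightarrow> bool" where
  "meeting P Q \<longleftrightarrow> (\<forall>p\<in>P. \<forall>q\<in>Q. p \<inter> q \<noteq> {})"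

definition choice_absorbing :: "'m set set \<Rightarrow> 'm set set \<Rightarrow> bool" where
  "choice_absorbing P Q \<longleftrightarrow> (\<forall>f. (\<forall>q\<in>Q. f q \<in> q) \<longrightarrow> (\<exists>p\<in>P. p \<subseteq> f ` Q))"

definition dual_families :: "'m set set \<Rightarrow> 'm set set \<Rightarrow> bool" where
  "dual_families P Q \<longleftrightarrow> meeting P Q \<and> choice_absorbing P Q \<and> choice_absorbing Q P"

lemma meeting_sym: "meeting P Q \<Longrightarrow> meeting Q P"
  by (auto simp: meeting_def)

text \<open>Absorption in the other direction is automatic. If for some choice function on \<open>P\<close> no
  \<open>q\<close> consisted of chosen points only, pick from each \<open>q\<close> a point that was not chosen. These
  points form a member of \<open>P\<close>, so one of them was chosen after all.\<close>

lemma dual_familiesI: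
  assumes meet: "\<And>p q. p \<in> P \<Longrightarrow> q \<in> Q \<Longrightarrow> p \<inter> q \<noteq> {}"
    and range: "\<And>f. (\<And>q. q \<in> Q \<Longrightarrow> f q \<in> q) \<Longrightarrow> f ` Q \<in> P"
  shows "dual_families P Q"
proof -
  have "\<exists>q\<in>Q. q \<subseteq> g ` P" if g: "\<forall>p\<in>P. g p \<in> p" for g
  proof (rule ccontr)
    assume "\<not> ?thesis"
    then have "\<forall>q\<in>Q. \<exists>x. x \<in> q \<and> x \<notin> g ` P" by blast
    then obtain f where f: "\<forall>q\<in>Q. f q \<in> q \<and> f q \<notin> g ` P" by metis
    then have "f ` Q \<in> P" using range by blast
    then have "g (f ` Q) \<in> f ` Q" "g (f ` Q) \<in> g ` P" using g by auto
    then show False using f by (metis imageE)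
  qed
  then have "choice_absorbing Q P" by (simp add: choice_absorbing_def)
  moreover have "choice_absorbing P Q"
    unfolding choice_absorbing_def using range by (metis subset_refl)
  moreover have "meeting P Q" using meet by (simp add: meeting_def)
  ultimately show ?thesis by (simp add: dual_families_def)
qed

text \<open>Two imagines One's winning strategy being played in the other game and answers \<open>q\<close> by a
  point of \<open>q\<close> in the set that this strategy would play. Both games then produce the same
  sequence of points.\<close>

lemma two_wins_if_one_wins:
  assumes "meeting P Q" and "one_wins (G1 P D)"
  shows "two_wins (G1 Q (- D))"
proof -
  obtain \<sigma> where \<sigma>: "\<forall>xs\<in>lists (\<Union>P). \<sigma> xs \<in> P"
    and win [rule_format]: "\<forall>x. (\<forall>n. x n \<in> \<sigma> (map x [0..<n])) \<longrightarrow> range x \<notin> D"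
    using assms(2) unfolding one_wins_def game.sel Compl_iff by blast
  define pick where "pick xs q = (SOME x. x \<in> \<sigma> xs \<inter> q)" for xs q
  have pick: "pick xs q \<in> \<sigma> xs \<inter> q" if "xs \<in> lists (\<Union>P)" "q \<in> Q" for xs q
    unfolding pick_def some_in_eq using \<sigma> that assms(1) by (auto simp: meeting_def)
  have replay_lists: "replay pick qs \<in> lists (\<Union>P)" if "qs \<in> lists Q" for qs
    using that
  proof (induction qs rule: rev_induct)
    case (snoc q qs)
    then have "pick (replay pick qs) q \<in> \<sigma> (replay pick qs)" "\<sigma> (replay pick qs) \<in> P"
      using pick \<sigma> by auto
    then show ?case using snoc by auto
  qed simp
  define \<tau> where "\<tau> qs = last (replay pick qs)" for qs
  have "\<tau> qs \<in> last qs" if "qs \<in> lists Q" "qs \<noteq> []" for qs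
  proof -
    obtain rs q where qs: "qs = rs @ [q]" using \<open>qs \<noteq> []\<close> by (cases qs rule: rev_cases) auto
    show ?thesis using pick[of "replay pick rs" q] replay_lists[of rs] that by (simp add: \<tau>_def qs)
  qed
  moreover have "range (\<lambda>n. \<tau> (map q [0..<Suc n])) \<notin> D" if q: "\<forall>n. q n \<in> Q" for q
  proof -
    define x where "x k = \<tau> (map q [0..<Suc k])" for k
    have x: "x k = pick (replay pick (map q [0..<k])) (q k)" for k
      by (simp add: x_def \<tau>_def)
    have run: "replay pick (map q [0..<n]) = map x [0..<n]" for n
      by (subst replay_run) (simp add: x)
    have "x n \<in> \<sigma> (map x [0..<n])" for n
      using pick[of "replay pick (map q [0..<n])" "q n"] replay_lists[of "map q [0..<n]"] q
      unfolding x run[symmetric] by (auto simp: in_lists_conv_set)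
    then show ?thesis using win[of x] by (simp add: x_def)
  qed
  ultimately show ?thesis unfolding two_wins_def by auto
qed

lemma two_wins_mark_if_one_wins_pre:
  assumes "meeting P Q" and "one_wins_pre (G1 P D)"
  shows "two_wins_mark (G1 Q (- D))"
proof -
  obtain \<sigma> :: "nat \<Rightarrow> 'a set" where \<sigma>: "\<And>n. \<sigma> n \<in> P"
    and win [rule_format]: "\<forall>x. (\<forall>n. x n \<in> \<sigma> n) \<longrightarrow> range x \<notin> D"
    using assms(2) unfolding one_wins_pre_def game.sel Compl_iff by blast
  define \<tau> where "\<tau> q n = (SOME x. x \<in> \<sigma> n \<inter> q)" for q n
  have "\<tau> q n \<in> \<sigma> n \<inter> q" if "q \<in> Q" for q n
    unfolding \<tau>_def some_in_eq using \<sigma> that assms(1) by (auto simp: meeting_def)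
  then show ?thesis
    unfolding two_wins_mark_def by (intro exI[of _ \<tau>]) (use win in auto)
qed

text \<open>In every position Two's strategy chooses a point from each possible next move of One. One
  in the other game plays a set consisting only of points chosen in this way, so whatever is
  picked from it is an answer of Two's strategy to some move.\<close>

lemma one_wins_if_two_wins:
  assumes "choice_absorbing P Q" and "two_wins (G1 Q (- D))"
  shows "one_wins (G1 P D)"
proof -
  obtain \<tau> where \<tau>: "\<forall>qs\<in>lists Q. qs \<noteq> [] \<longrightarrow> \<tau> qs \<in> last qs"
    and win [rule_format]: "\<forall>q. (\<forall>n. q n \<in> Q) \<longrightarrow> range (\<lambda>n. \<tau> (map q [0..<Suc n])) \<notin> D"
    using assms(2) unfolding two_wins_def game.sel Compl_iff by blast
  define ask where "ask qs x = (SOME q. q \<in> Q \<and> x = \<tau> (qs @ [q]))" for qs x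
  define \<sigma> where "\<sigma> xs = (SOME p. p \<in> P \<and> p \<subseteq> (\<lambda>q. \<tau> (replay ask xs @ [q])) ` Q)" for xs
  have \<sigma>: "\<sigma> xs \<in> P \<and> \<sigma> xs \<subseteq> (\<lambda>q. \<tau> (replay ask xs @ [q])) ` Q"
    if "replay ask xs \<in> lists Q" for xs
  proof -
    have "\<forall>q\<in>Q. \<tau> (replay ask xs @ [q]) \<in> q"
      using bspec[OF \<tau>, of "replay ask xs @ [_]"] that by simp
    then have "\<exists>p. p \<in> P \<and> p \<subseteq> (\<lambda>q. \<tau> (replay ask xs @ [q])) ` Q"
      using assms(1)[unfolded choice_absorbing_def,
          THEN spec[of _ "\<lambda>q. \<tau> (replay ask xs @ [q])"]] by blast
    then show ?thesis unfolding \<sigma>_def by (rule someI_ex)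
  qed
  have ask: "ask (replay ask xs) x \<in> Q \<and> x = \<tau> (replay ask xs @ [ask (replay ask xs) x])"
    if "replay ask xs \<in> lists Q" "x \<in> \<sigma> xs" for xs x
  proof -
    have "\<exists>q. q \<in> Q \<and> x = \<tau> (replay ask xs @ [q])" using \<sigma>[OF that(1)] that(2) by blast
    from someI_ex[OF this] show ?thesis unfolding ask_def .
  qed
  have legal_lists: "replay ask xs \<in> lists Q" if "legal_play \<sigma> xs" for xs
    using that by (induction xs rule: rev_induct) (use ask in auto)
  show ?thesis
  proof (rule one_wins_by_legal_plays)
    show "\<sigma> xs \<in> one_moves (G1 P D)" if "legal_play \<sigma> xs" for xs
      using \<sigma> legal_lists[OF that] by simp
  next
    fix x assume x: "\<And>n. x n \<in> \<sigma> (map x [0..<n])"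
    have "legal_play \<sigma> (map x [0..<n])" for n
      by (induction n) (use x in auto)
    then have in_Q: "replay ask (map x [0..<n]) \<in> lists Q" for n
      using legal_lists by blast
    define q where "q k = ask (replay ask (map x [0..<k])) (x k)" for k
    have run: "replay ask (map x [0..<n]) = map q [0..<n]" for n
      by (subst replay_run) (simp add: q_def)
    have "q n \<in> Q" "x n = \<tau> (map q [0..<Suc n])" for n
      using ask[OF in_Q x, of n] run[of n] by (auto simp: q_def)
    then show "range x \<notin> two_goal (G1 P D)" using win[of q] by auto
  qed
qed

lemma one_wins_pre_if_two_wins_mark:
  assumes "choice_absorbing P Q" and "two_wins_mark (G1 Q (- D))"
  shows "one_wins_pre (G1 P D)"
proof -
  obtain \<tau> :: "'a set \<Rightarrow> nat \<Rightarrow> 'a" where \<tau>: "\<forall>q\<in>Q. \<forall>n. \<tau> q n \<in> q"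
    and win [rule_format]: "\<forall>q. (\<forall>n. q n \<in> Q) \<longrightarrow> range (\<lambda>n. \<tau> (q n) n) \<notin> D"
    using assms(2) unfolding two_wins_mark_def game.sel Compl_iff by blast
  have "\<exists>p. p \<in> P \<and> p \<subseteq> (\<lambda>q. \<tau> q n) ` Q" for n
    using assms(1)[unfolded choice_absorbing_def, THEN spec[of _ "\<lambda>q. \<tau> q n"]] \<tau> by blast
  then obtain \<sigma> where \<sigma>: "\<And>n. \<sigma> n \<in> P \<and> \<sigma> n \<subseteq> (\<lambda>q. \<tau> q n) ` Q" by metis
  have "range x \<notin> D" if x: "\<forall>n. x n \<in> \<sigma> n" for x
  proof -
    have "\<forall>n. \<exists>q. q \<in> Q \<and> x n = \<tau> q n" using x \<sigma> by blast
    then obtain q where "\<And>n. q n \<in> Q \<and> x n = \<tau> (q n) n" by metis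
    then show ?thesis using win[of q] by auto
  qed
  then show ?thesis unfolding one_wins_pre_def using \<sigma> by auto
qed

theorem dual_games_if_dual_families:
  assumes "dual_families P Q"
  shows "dual_games (G1 P D) (G1 Q (- D))"
proof -
  have meet: "meeting P Q" "meeting Q P"
    and absorb: "choice_absorbing P Q" "choice_absorbing Q P"
    using assms meeting_sym unfolding dual_families_def by blast+
  show ?thesis
    unfolding dual_games_def
    using two_wins_if_one_wins[OF meet(1), of D] one_wins_if_two_wins[OF absorb(1), of D]
      two_wins_if_one_wins[OF meet(2), of "- D"] one_wins_if_two_wins[OF absorb(2), of "- D"]
      two_wins_mark_if_one_wins_pre[OF meet(1), of D]
      one_wins_pre_if_two_wins_mark[OF absorb(1), of D]
      two_wins_mark_if_one_wins_pre[OF meet(2), of "- D"]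
      one_wins_pre_if_two_wins_mark[OF absorb(2), of "- D"]
    by auto
qed

lemma equivalent_games_duals:
  assumes "equivalent_games G G'" "dual_games G H" "dual_games G' H'"
  shows "equivalent_games H H'"
  using assms by (simp add: equivalent_games_def dual_games_def)

lemma dual_families_clustering:
  assumes "point_nbhds Y y \<noteq> {}"
  shows "dual_families (clustering_sets Y y) (point_nbhds Y y)"
proof (rule dual_familiesI)
  fix p q assume "p \<in> clustering_sets Y y" "q \<in> point_nbhds Y y"
  then show "p \<inter> q \<noteq> {}"
    by (auto simp: clustering_sets_def point_nbhds_def proper_opens_def in_closure_of)
next
  fix f assume f: "\<And>q. q \<in> point_nbhds Y y \<Longrightarrow> f q \<in> q"
  have sub: "f ` point_nbhds Y y \<subseteq> topspace Y"
    using f openin_subset by (fastforce simp: point_nbhds_def proper_opens_def)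
  have y: "y \<in> topspace Y"
    using assms openin_subset by (fastforce simp: point_nbhds_def proper_opens_def)
  have "\<exists>z. z \<in> f ` point_nbhds Y y \<and> z \<in> T" if T: "openin Y T" "y \<in> T" for T
  proof (cases "T = topspace Y")
    case True
    then show ?thesis using assms sub by blast
  next
    case False
    then have "T \<in> point_nbhds Y y" using T by (auto simp: point_nbhds_def proper_opens_def)
    then show ?thesis using f by blast
  qed
  then show "f ` point_nbhds Y y \<in> clustering_sets Y y"
    using sub y by (auto simp: clustering_sets_def in_closure_of)
qed

lemma dual_families_dense:
  assumes "proper_opens Y \<noteq> {}"
  shows "dual_families (dense_sets Y) (proper_opens Y)"
proof (rule dual_familiesI)
  fix p q assume p: "p \<in> dense_sets Y" and q: "q \<in> proper_opens Y"
  have "q \<noteq> {}" "openin Y q" using q by (simp_all add: proper_opens_def)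
  moreover have "Y closure_of p = topspace Y" using p by (simp add: dense_sets_def)
  ultimately show "p \<inter> q \<noteq> {}"
    using openin_Int_closure_of_eq_empty[of Y q p] openin_subset[of Y q] by blast
next
  fix f assume f: "\<And>q. q \<in> proper_opens Y \<Longrightarrow> f q \<in> q"
  have sub: "f ` proper_opens Y \<subseteq> topspace Y"
  proof (rule image_subsetI)
    fix q assume q: "q \<in> proper_opens Y"
    then have "q \<subseteq> topspace Y" by (simp add: proper_opens_def openin_subset)
    then show "f q \<in> topspace Y" using f[OF q] by blast
  qed
  have "\<exists>z. z \<in> f ` proper_opens Y \<and> z \<in> T" if T: "openin Y T" "y \<in> T" for T y
  proof (cases "T = topspace Y")
    case True
    then show ?thesis using assms sub by blast
  next
    case False
    then have "T \<in> proper_opens Y" using T by (auto simp: proper_opens_def)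
    then show ?thesis using f by blast
  qed
  then have "topspace Y \<subseteq> Y closure_of (f ` proper_opens Y)"
    unfolding in_closure_of subset_iff by blast
  then show "f ` proper_opens Y \<in> dense_sets Y"
    using sub by (simp add: dense_sets_def closure_of_subset_topspace subset_antisym)
qed


section \<open>Covers indexed by an ideal\<close>

lemma closed_idealD:
  assumes "closed_ideal \<A>"
  shows "A \<in> \<A> \<Longrightarrow> A \<noteq> {}"
    and "A \<in> \<A> \<Longrightarrow> A \<noteq> UNIV"
    and "A \<in> \<A> \<Longrightarrow> A' \<in> \<A> \<Longrightarrow> A \<union> A' \<in> \<A>"
    and "{x} \<in> \<A>"
proof -
  note parts = assms[unfolded closed_ideal_def]
  note nonempty = parts[THEN conjunct1]
    and union = parts[THEN conjunct2, THEN conjunct1]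
    and point = parts[THEN conjunct2, THEN conjunct2, THEN conjunct2, THEN conjunct1]
    and proper = parts[THEN conjunct2, THEN conjunct2, THEN conjunct2, THEN conjunct2]
  show "A \<in> \<A> \<Longrightarrow> A \<noteq> {}" using nonempty by blast
  show "A \<in> \<A> \<Longrightarrow> A \<noteq> UNIV" using proper by blast
  show "A \<in> \<A> \<Longrightarrow> A' \<in> \<A> \<Longrightarrow> A \<union> A' \<in> \<A>" using union by blast
  show "{x} \<in> \<A>" using point by blast
qed

lemma ideal_coversI:
  assumes "closed_ideal \<A>" and "\<And>U. U \<in> \<U> \<Longrightarrow> open U \<and> U \<noteq> {} \<and> U \<noteq> UNIV"
    and "\<And>A. A \<in> \<A> \<Longrightarrow> \<exists>U\<in>\<U>. A \<subseteq> U"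
  shows "\<U> \<in> ideal_covers \<A>"
proof -
  have "\<exists>U\<in>\<U>. x \<in> U" for x
    using assms(3)[OF closed_idealD(4)[OF assms(1)], of x] by blast
  then have "\<Union>\<U> = UNIV" by blast
  then show ?thesis using assms(2,3) by (simp add: ideal_covers_def) blast
qed

lemma dual_families_covers:
  fixes \<A> :: "'a::t1_space set set"
  assumes "closed_ideal \<A>"
  shows "dual_families (ideal_covers \<A>) (set_nbhds (euclidean :: 'a topology) ` \<A>)"
proof (rule dual_familiesI)
  fix p q assume p: "p \<in> ideal_covers \<A>" and "q \<in> set_nbhds (euclidean :: 'a topology) ` \<A>"
  then obtain A where A: "A \<in> \<A>" "q = set_nbhds euclidean A" by blast
  obtain U where "U \<in> p" "A \<subseteq> U" using p A by (auto simp: ideal_covers_def)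
  then have "U \<in> p \<inter> q"
    using p by (auto simp: A set_nbhds_def proper_opens_def ideal_covers_def)
  then show "p \<inter> q \<noteq> {}" by blast
next
  fix f assume f: "\<And>q. q \<in> set_nbhds (euclidean :: 'a topology) ` \<A> \<Longrightarrow> f q \<in> q"
  have fA: "f (set_nbhds euclidean A) \<in> set_nbhds euclidean A" if "A \<in> \<A>" for A
    using f that by blast
  show "f ` set_nbhds euclidean ` \<A> \<in> ideal_covers \<A>"
  proof (rule ideal_coversI[OF assms])
    show "open U \<and> U \<noteq> {} \<and> U \<noteq> UNIV" if "U \<in> f ` set_nbhds euclidean ` \<A>" for U
      using that fA by (fastforce simp: set_nbhds_def proper_opens_def)
    show "\<exists>U\<in>f ` set_nbhds euclidean ` \<A>. A \<subseteq> U" if "A \<in> \<A>" for A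
      using that fA[OF that] by (auto simp: set_nbhds_def)
  qed
qed

text \<open>Adding to \<open>B\<close> one point outside each of finitely many members of the cover stays inside
  the ideal, and the member of the cover containing the enlarged set is not among them.\<close>

lemma ideal_cover_late_member:
  fixes U :: "nat \<Rightarrow> 'a::topological_space set"
  assumes "closed_ideal \<B>" "range U \<in> ideal_covers \<B>" "B \<in> \<B>"
  obtains n where "n \<ge> N" "B \<subseteq> U n"
proof -
  have "\<exists>y. y \<notin> U i" for i
    using assms(2) by (auto simp: ideal_covers_def)
  then obtain p where p: "\<And>i. p i \<notin> U i" by metis
  have "B \<union> p ` {..<N} \<in> \<B>"
  proof (induction N)
    case (Suc N)
    have "(B \<union> p ` {..<N}) \<union> {p N} \<in> \<B>"
      by (intro closed_idealD(3,4) assms(1) Suc)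
    then show ?case by (simp add: lessThan_Suc Un_commute)
  qed (use assms in simp)
  then obtain n where n: "B \<union> p ` {..<N} \<subseteq> U n"
    using assms(2) by (auto simp: ideal_covers_def)
  then have "n \<ge> N" using p[of n] by (auto simp: not_less[symmetric])
  then show thesis using that n by blast
qed


section \<open>Constructing minimal cusco maps\<close>

text \<open>Zorn's lemma: along a chain of cusco maps the values at a point are nested compact sets, so
  an open set that contains their intersection contains one of them. This makes the pointwise
  intersection non-empty-valued and upper semicontinuous.\<close>

lemma cusco_contains_minimal:
  fixes \<Theta> :: "'a::topological_space \<Rightarrow> real set"
  assumes "cusco \<Theta>"
  obtains \<Phi> where "\<Phi> \<in> minimal_cusco" "\<And>x. \<Phi> x \<subseteq> \<Theta> x"
proof -
  \<comment> \<open>Complements of graphs turn minimality into maximality.\<close>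
  define \<G> where "\<G> = {- map_graph \<Phi> |\<Phi>. cusco \<Phi> \<and> map_graph \<Phi> \<subseteq> map_graph \<Theta>}"
  define section_at where "section_at C x = {y. (x, y) \<notin> C}" for C :: "('a \<times> real) set" and x
  have in_\<G>: "C \<in> \<G> \<longleftrightarrow> cusco (section_at C) \<and> - C \<subseteq> map_graph \<Theta>" for C
  proof
    show "cusco (section_at C) \<and> - C \<subseteq> map_graph \<Theta>" if "C \<in> \<G>"
      using that by (auto simp: \<G>_def section_at_def[abs_def] map_graph_def)
    assume "cusco (section_at C) \<and> - C \<subseteq> map_graph \<Theta>"
    moreover have "C = - map_graph (section_at C)" by (auto simp: section_at_def map_graph_def)
    ultimately show "C \<in> \<G>"
      unfolding \<G>_def mem_Collect_eq by (intro exI[of _ "section_at C"]) auto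
  qed
  have "\<Union>\<C> \<in> \<G>" if "\<C> \<noteq> {}" and chain: "subset.chain \<G> \<C>" for \<C>
  proof -
    have \<C>: "\<C> \<subseteq> \<G>" and total: "\<And>C C'. C \<in> \<C> \<Longrightarrow> C' \<in> \<C> \<Longrightarrow> C \<subseteq> C' \<or> C' \<subseteq> C"
      using chain by (auto simp: subset_chain_def)
    have cusco: "cusco (section_at C)" if "C \<in> \<C>" for C using \<C> that in_\<G> by blast
    have section_Union: "section_at (\<Union>\<C>) x = (\<Inter>C\<in>\<C>. section_at C x)" for x
      by (auto simp: section_at_def)
    have capture: "\<exists>C\<in>\<C>. section_at C x \<subseteq> W"
      if W: "open W" "section_at (\<Union>\<C>) x \<subseteq> W" for W x
    proof (rule ccontr)
      assume none: "\<not> ?thesis"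
      have "\<Inter>((\<lambda>C. section_at C x - W) ` \<C>) \<noteq> {}"
      proof (rule compact_chain)
        show "{} \<notin> (\<lambda>C. section_at C x - W) ` \<C>" using none by blast
      next
        fix K assume "K \<in> (\<lambda>C. section_at C x - W) ` \<C>"
        then obtain C where "C \<in> \<C>" "K = section_at C x - W" by blast
        then show "compact K"
          using cusco W by (auto simp: cusco_def intro!: compact_diff)
      next
        fix K L
        assume "K \<in> (\<lambda>C. section_at C x - W) ` \<C> \<and> L \<in> (\<lambda>C. section_at C x - W) ` \<C>"
        then obtain C C' where "C \<in> \<C>" "C' \<in> \<C>" "K = section_at C x - W" "L = section_at C' x - W"
          by blast
        then show "K \<subseteq> L \<or> L \<subseteq> K" using total[of C C'] by (auto simp: section_at_def)
      qed
      then show False using W \<open>\<C> \<noteq> {}\<close> by (auto simp: section_Union)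
    qed
    have "section_at (\<Union>\<C>) x \<noteq> {}" for x
      using capture[of "{}" x] cusco by (auto simp: cusco_def)
    moreover have "compact (section_at (\<Union>\<C>) x)" "convex (section_at (\<Union>\<C>) x)" for x
      unfolding section_Union using cusco \<open>\<C> \<noteq> {}\<close>
      by (auto simp: cusco_def intro!: compact_Inter convex_INT)
    moreover have "open {x. section_at (\<Union>\<C>) x \<subseteq> W}" if W: "open W" for W
    proof -
      have "{x. section_at (\<Union>\<C>) x \<subseteq> W} = (\<Union>C\<in>\<C>. {x. section_at C x \<subseteq> W})"
        using capture[OF W] by (auto simp: section_Union)
      then show ?thesis using cusco W by (auto simp: cusco_def)
    qed
    moreover have "- \<Union>\<C> \<subseteq> map_graph \<Theta>"
      using \<C> \<open>\<C> \<noteq> {}\<close> in_\<G> by blast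
    ultimately show ?thesis by (auto simp: in_\<G> cusco_def)
  qed
  moreover have "\<G> \<noteq> {}" using assms by (auto simp: \<G>_def)
  ultimately obtain M where M: "M \<in> \<G>" and max: "\<forall>C\<in>\<G>. M \<subseteq> C \<longrightarrow> C = M"
    using subset_Zorn_nonempty[of \<G>] by blast
  obtain \<Phi> where \<Phi>: "cusco \<Phi>" "map_graph \<Phi> \<subseteq> map_graph \<Theta>" and "M = - map_graph \<Phi>"
    using M by (auto simp: \<G>_def)
  have "map_graph \<Psi> = map_graph \<Phi>" if "cusco \<Psi>" "map_graph \<Psi> \<subseteq> map_graph \<Phi>" for \<Psi>
  proof -
    have "- map_graph \<Psi> \<in> \<G>" using that \<Phi> by (auto simp: \<G>_def)
    then show ?thesis using max that \<open>M = - map_graph \<Phi>\<close> by blast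
  qed
  then show thesis
    using that[of \<Phi>] \<Phi> by (auto simp: minimal_cusco_def map_graph_def)
qed

lemma minimal_cusco_nonempty: "\<Phi> \<in> minimal_cusco \<Longrightarrow> \<Phi> x \<noteq> {}"
  by (simp add: minimal_cusco_def cusco_def)

lemma const_minimal_cusco: "(\<lambda>_::'a::topological_space. {c}) \<in> minimal_cusco"
proof -
  have "cusco (\<lambda>_::'a. {c})" by (auto simp: cusco_def)
  then obtain \<Phi> :: "'a \<Rightarrow> real set" where \<Phi>: "\<Phi> \<in> minimal_cusco" "\<And>x. \<Phi> x \<subseteq> {c}"
    by (rule cusco_contains_minimal) blast
  then have "\<Phi> x = {c}" for x
    using minimal_cusco_nonempty[OF \<Phi>(1), of x] by blast
  then have "\<Phi> = (\<lambda>_. {c})" by blast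
  then show ?thesis using \<Phi>(1) by simp
qed

text \<open>Some cusco map has the prescribed values off the boundary of \<open>V\<close>: at a boundary point take
  all values between \<open>c\<close> and the values of \<open>\<Psi>\<close>. A minimal cusco map below it agrees with
  \<open>\<Psi>\<close> on \<open>V\<close>, for otherwise \<open>\<Psi>\<close> could be shrunk on the open set \<open>V\<close>.\<close>

lemma minimal_cusco_patch_constant:
  fixes \<Psi> :: "'a::topological_space \<Rightarrow> real set"
  assumes \<Psi>: "\<Psi> \<in> minimal_cusco" and V: "open V"
  obtains \<Phi> where "\<Phi> \<in> minimal_cusco"
    "\<And>x. x \<in> V \<Longrightarrow> \<Phi> x = \<Psi> x" "\<And>x. x \<notin> closure V \<Longrightarrow> \<Phi> x = {c}"
proof -
  have cusco_\<Psi>: "cusco \<Psi>" using \<Psi> by (simp add: minimal_cusco_def)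
  define \<Theta> where "\<Theta> x = (if x \<in> V then \<Psi> x else if x \<notin> closure V then {c}
      else convex hull (insert c (\<Psi> x)))" for x
  have \<Theta>_off: "\<Theta> x = {c}" if "x \<notin> closure V" for x
    using that subsetD[OF closure_subset, of x V] by (auto simp: \<Theta>_def)
  have \<Theta>_hull: "\<Theta> x \<subseteq> convex hull (insert c (\<Psi> x))" for x
    using hull_subset[of "insert c (\<Psi> x)" convex] by (auto simp: \<Theta>_def)
  have "open {x. \<Theta> x \<subseteq> W}" if W: "open W" for W
  proof (subst open_subopen, intro ballI)
    fix x assume "x \<in> {x. \<Theta> x \<subseteq> W}"
    then have x: "\<Theta> x \<subseteq> W" by simp
    consider "x \<in> V" | "x \<notin> closure V" | "x \<notin> V" "x \<in> closure V" by blast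
    then show "\<exists>T. open T \<and> x \<in> T \<and> T \<subseteq> {x. \<Theta> x \<subseteq> W}"
    proof cases
      case 1
      then show ?thesis
        using x V W cusco_\<Psi>
        by (intro exI[of _ "V \<inter> {x. \<Psi> x \<subseteq> W}"]) (auto simp: \<Theta>_def cusco_def)
    next
      case 2
      then show ?thesis
        using x \<Theta>_off by (intro exI[of _ "- closure V"]) auto
    next
      case 3
      \<comment> \<open>Only a convex neighbourhood of the hull controls the hulls at nearby points.\<close>
      define I where "I = connected_component_set W c"
      have hull: "convex hull (insert c (\<Psi> x)) \<subseteq> W" using x 3 by (simp add: \<Theta>_def)
      have c: "c \<in> convex hull (insert c (\<Psi> x))" by (simp add: hull_inc)
      have hull_I: "convex hull (insert c (\<Psi> x)) \<subseteq> I"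
        unfolding I_def
        by (intro connected_component_maximal c hull convex_connected convex_convex_hull)
      have "open I" using W by (simp add: I_def open_connected_component)
      moreover have "convex I"
        by (simp add: I_def connected_convex_1[symmetric])
      moreover have "c \<in> I" "\<Psi> x \<subseteq> I"
        using hull_I c hull_subset[of "insert c (\<Psi> x)" convex] by blast+
      moreover have "I \<subseteq> W" unfolding I_def by (rule connected_component_subset)
      ultimately have "convex hull (insert c (\<Psi> z)) \<subseteq> W" if "\<Psi> z \<subseteq> I" for z
        using that hull_minimal[of "insert c (\<Psi> z)" I convex] by simp
      then have "{x. \<Psi> x \<subseteq> I} \<subseteq> {x. \<Theta> x \<subseteq> W}" using \<Theta>_hull by blast
      moreover have "open {x. \<Psi> x \<subseteq> I}" using \<open>open I\<close> cusco_\<Psi> by (simp add: cusco_def)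
      ultimately show ?thesis
        using \<open>\<Psi> x \<subseteq> I\<close> by (intro exI[of _ "{x. \<Psi> x \<subseteq> I}"]) simp
    qed
  qed
  then have "cusco \<Theta>"
    using cusco_\<Psi> by (auto simp: cusco_def \<Theta>_def compact_convex_hull)
  then obtain \<Phi> where \<Phi>: "\<Phi> \<in> minimal_cusco" and sub: "\<And>x. \<Phi> x \<subseteq> \<Theta> x"
    by (rule cusco_contains_minimal) blast
  have cusco_\<Phi>: "cusco \<Phi>" using \<Phi> by (simp add: minimal_cusco_def)
  define \<Psi>' where "\<Psi>' x = (if x \<in> V then \<Phi> x else \<Psi> x)" for x
  have sub_V: "\<Phi> x \<subseteq> \<Psi> x" if "x \<in> V" for x using sub[of x] that by (simp add: \<Theta>_def)
  have "cusco \<Psi>'"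
  proof -
    have "{x. \<Psi>' x \<subseteq> W} = (V \<inter> {x. \<Phi> x \<subseteq> W}) \<union> {x. \<Psi> x \<subseteq> W}" for W
      using sub_V by (auto simp: \<Psi>'_def split: if_splits)
    then have "open {x. \<Psi>' x \<subseteq> W}" if "open W" for W
      using that cusco_\<Phi> cusco_\<Psi> V by (simp add: cusco_def open_Int open_Un)
    moreover have "\<Psi>' x \<noteq> {} \<and> compact (\<Psi>' x) \<and> convex (\<Psi>' x)" for x
      using cusco_\<Phi> cusco_\<Psi> by (simp add: cusco_def \<Psi>'_def)
    ultimately show ?thesis by (simp add: cusco_def)
  qed
  moreover have "map_graph \<Psi>' \<subseteq> map_graph \<Psi>"
    using sub_V by (auto simp: map_graph_def \<Psi>'_def subset_iff split: if_splits)
  ultimately have "map_graph \<Psi>' = map_graph \<Psi>"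
    using \<Psi> by (simp add: minimal_cusco_def)
  then have "\<Psi>' x = \<Psi> x" for x by (auto simp: map_graph_def set_eq_iff)
  then have "\<Phi> x = \<Psi> x" if "x \<in> V" for x using that by (metis \<Psi>'_def)
  moreover have "\<Phi> x = {c}" if "x \<notin> closure V" for x
  proof -
    have "\<Phi> x \<subseteq> {c}" using sub[of x] \<Theta>_off[OF that] by simp
    then show ?thesis using minimal_cusco_nonempty[OF \<Phi>, of x] by blast
  qed
  ultimately show thesis using that \<Phi> by blast
qed


section \<open>Closures in the space of minimal cusco maps\<close>

text \<open>A pointwise bound by \<open>\<epsilon>\<close> on a non-compact \<open>A\<close> is not stable under small uniform
  perturbations; a uniform bound \<open>\<delta> < \<epsilon>\<close> leaves room for them.\<close>

lemma openin_uniformly_small: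
  assumes "closed_ideal \<A>" "A \<in> \<A>"
  shows "openin (mc_space \<A>) {\<Phi> \<in> minimal_cusco. \<exists>\<delta><\<epsilon>. \<forall>x\<in>A. \<Phi> x \<subseteq> cball 0 \<delta>}"
    (is "openin _ ?T")
proof -
  have "\<exists>\<gamma>>0. mc_entourage A \<gamma> `` {\<Phi>} \<subseteq> ?T" if \<Phi>: "\<Phi> \<in> ?T" for \<Phi>
  proof -
    obtain \<delta> where \<delta>: "\<delta> < \<epsilon>" "\<forall>x\<in>A. \<Phi> x \<subseteq> cball 0 \<delta>" using \<Phi> by blast
    define \<gamma> where "\<gamma> = (\<epsilon> - \<delta>) / 2"
    have "\<Psi> \<in> ?T" if \<Psi>: "(\<Phi>, \<Psi>) \<in> mc_entourage A \<gamma>" for \<Psi>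
    proof -
      have "\<bar>z\<bar> \<le> \<delta> + \<gamma>" if xz: "x \<in> A" "z \<in> \<Psi> x" for x z
      proof -
        obtain y where "y \<in> \<Phi> x" "z \<in> ball y \<gamma>" using \<Psi> xz unfolding mc_entourage_def by blast
        moreover from this have "\<bar>y\<bar> \<le> \<delta>" using \<delta>(2) xz(1) by fastforce
        ultimately show ?thesis by (auto simp: dist_real_def)
      qed
      moreover have "\<delta> + \<gamma> < \<epsilon>" using \<delta>(1) by (simp add: \<gamma>_def field_simps)
      moreover have "\<Psi> \<in> minimal_cusco" using \<Psi> by (simp add: mc_entourage_def)
      ultimately show ?thesis by (auto intro!: exI[of _ "\<delta> + \<gamma>"])
    qed
    moreover have "\<gamma> > 0" using \<delta>(1) by (simp add: \<gamma>_def)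
    ultimately show ?thesis by blast
  qed
  then show ?thesis
    unfolding openin_mc_space[OF assms(1)] using assms(2) by blast
qed

lemma clustering_zero_iff:
  assumes "closed_ideal \<A>"
  shows "F \<in> clustering_sets (mc_space \<A>) zero_map \<longleftrightarrow>
    F \<subseteq> minimal_cusco \<and> (\<forall>A\<in>\<A>. \<forall>\<epsilon>>0. \<exists>\<Phi>\<in>F. \<forall>x\<in>A. \<Phi> x \<subseteq> ball 0 \<epsilon>)"
proof (intro iffI conjI ballI allI impI)
  assume F: "F \<in> clustering_sets (mc_space \<A>) zero_map"
  then show "F \<subseteq> minimal_cusco"
    by (simp add: clustering_sets_def topspace_mc_space[OF assms])
  fix A and \<epsilon> :: real assume A: "A \<in> \<A>" and \<epsilon>: "\<epsilon> > 0"
  let ?T = "{\<Phi> \<in> minimal_cusco. \<exists>\<delta><\<epsilon>. \<forall>x\<in>A. \<Phi> x \<subseteq> cball 0 \<delta>}"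
  have "zero_map \<in> ?T"
    using \<epsilon> zero_map_minimal_cusco by (auto simp: zero_map_def intro!: exI[of _ 0])
  moreover have "openin (mc_space \<A>) ?T" by (rule openin_uniformly_small[OF assms A])
  moreover have "zero_map \<in> mc_space \<A> closure_of F"
    using F by (simp add: clustering_sets_def)
  ultimately have "\<exists>\<Phi>. \<Phi> \<in> F \<and> \<Phi> \<in> ?T"
    unfolding in_closure_of by (elim conjE allE[of _ ?T] impE) (intro conjI)
  then obtain \<Phi> \<delta> where \<Phi>: "\<Phi> \<in> F" "\<delta> < \<epsilon>" "\<forall>x\<in>A. \<Phi> x \<subseteq> cball 0 \<delta>"
    by blast
  moreover from \<open>\<delta> < \<epsilon>\<close> have "cball 0 \<delta> \<subseteq> ball (0::real) \<epsilon>" by auto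
  ultimately show "\<exists>\<Phi>\<in>F. \<forall>x\<in>A. \<Phi> x \<subseteq> ball 0 \<epsilon>" by (meson order_trans)
next
  assume F: "F \<subseteq> minimal_cusco \<and> (\<forall>A\<in>\<A>. \<forall>\<epsilon>>0. \<exists>\<Phi>\<in>F. \<forall>x\<in>A. \<Phi> x \<subseteq> ball 0 \<epsilon>)"
  have "\<exists>\<Phi>. \<Phi> \<in> F \<and> \<Phi> \<in> T" if T: "zero_map \<in> T" "openin (mc_space \<A>) T" for T
  proof -
    obtain A \<epsilon> where A: "A \<in> \<A>" "\<epsilon> > 0" "mc_entourage A \<epsilon> `` {zero_map} \<subseteq> T"
      using T unfolding openin_mc_space[OF assms] by blast
    then obtain \<Phi> where \<Phi>: "\<Phi> \<in> F" "\<forall>x\<in>A. \<Phi> x \<subseteq> ball 0 \<epsilon>" using F by blast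
    then have mc: "\<Phi> \<in> minimal_cusco" using F by blast
    have "{0} \<subseteq> (\<Union>y\<in>\<Phi> x. ball y \<epsilon>)" if "x \<in> A" for x
    proof -
      obtain y where "y \<in> \<Phi> x" using minimal_cusco_nonempty[OF mc, of x] by blast
      moreover from this have "y \<in> ball 0 \<epsilon>" using \<Phi>(2) that by blast
      then have "0 \<in> ball y \<epsilon>" by simp
      ultimately show ?thesis by blast
    qed
    then have "(zero_map, \<Phi>) \<in> mc_entourage A \<epsilon>"
      using \<Phi>(2) mc zero_map_minimal_cusco by (auto simp: mc_entourage_def zero_map_def)
    then show ?thesis using \<Phi>(1) A(3) by blast
  qed
  then have "zero_map \<in> mc_space \<A> closure_of F"
    unfolding in_closure_of topspace_mc_space[OF assms] using zero_map_minimal_cusco by blast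
  then show "F \<in> clustering_sets (mc_space \<A>) zero_map"
    using F by (simp add: clustering_sets_def topspace_mc_space[OF assms])
qed

lemma point_nbhds_zero_nonempty:
  assumes "closed_ideal \<A>"
  shows "point_nbhds (mc_space \<A>) zero_map \<noteq> {}"
proof -
  obtain A where A: "A \<in> \<A>" "A \<noteq> {}" using closed_idealD(1,4)[OF assms] by blast
  define T where
    "T = {\<Phi> \<in> minimal_cusco. \<exists>\<delta><1. \<forall>x\<in>A. \<Phi> x \<subseteq> cball (0::real) \<delta>}"
  have "openin (mc_space \<A>) T" unfolding T_def by (rule openin_uniformly_small[OF assms A(1)])
  moreover have "zero_map \<in> T"
    using zero_map_minimal_cusco by (auto simp: T_def zero_map_def intro!: exI[of _ 0])
  moreover have "(\<lambda>_. {1}) \<notin> T" using A(2) by (auto simp: T_def)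
  then have "T \<noteq> minimal_cusco" using const_minimal_cusco[of 1] by blast
  ultimately have "T \<in> point_nbhds (mc_space \<A>) zero_map"
    by (auto simp: point_nbhds_def proper_opens_def topspace_mc_space[OF assms])
  then show ?thesis by blast
qed

text \<open>To approximate \<open>\<Psi>\<close> on \<open>A\<close>, take \<open>U\<close> in the cover around \<open>A\<close>, use normality to separate \<open>A\<close>
  from the complement of \<open>U\<close>, and replace \<open>\<Psi>\<close> by the constant far from \<open>A\<close>.\<close>

lemma dense_constant_off_cover:
  assumes \<A>: "closed_ideal \<A>" "ideal_normal \<A>" and \<U>: "\<U> \<in> ideal_covers \<A>"
  shows "{\<Phi> \<in> minimal_cusco. \<exists>U\<in>\<U>. \<forall>x. x \<notin> U \<longrightarrow> \<Phi> x = {c}} \<in> dense_sets (mc_space \<A>)"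
    (is "?D \<in> _")
proof -
  have "\<exists>\<Phi>. \<Phi> \<in> ?D \<and> \<Phi> \<in> T" if T: "\<Psi> \<in> T" "openin (mc_space \<A>) T" for \<Psi> T
  proof -
    obtain A \<epsilon> where A: "A \<in> \<A>" "\<epsilon> > 0" "mc_entourage A \<epsilon> `` {\<Psi>} \<subseteq> T"
      and \<Psi>: "\<Psi> \<in> minimal_cusco"
      using T unfolding openin_mc_space[OF \<A>(1)] by blast
    have "\<forall>A\<in>\<A>. \<exists>U\<in>\<U>. A \<subseteq> U" "\<forall>U\<in>\<U>. open U"
      using \<U> by (simp_all add: ideal_covers_def)
    then obtain U where U: "U \<in> \<U>" "open U" "A \<subseteq> U" using A(1) by blast
    then obtain V where V: "open V" "A \<subseteq> V" "closure V \<subseteq> U"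
      using \<A>(2)[unfolded ideal_normal_def, rule_format, OF A(1), of U] by blast
    obtain \<Phi> where \<Phi>: "\<Phi> \<in> minimal_cusco"
      and on_V: "\<And>x. x \<in> V \<Longrightarrow> \<Phi> x = \<Psi> x" and off: "\<And>x. x \<notin> closure V \<Longrightarrow> \<Phi> x = {c}"
      by (rule minimal_cusco_patch_constant[OF \<Psi> V(1), where c = c]) blast
    have "\<Phi> x = \<Psi> x" if "x \<in> A" for x using on_V V(2) that by blast
    then have "(\<Psi>, \<Phi>) \<in> mc_entourage A \<epsilon>"
      using \<Psi> \<Phi> by (auto simp: mc_entourage_def intro!: bexI centre_in_ball[THEN iffD2] \<open>\<epsilon> > 0\<close>)
    then have "\<Phi> \<in> T" using A(3) by blast
    moreover have "\<Phi> \<in> ?D" using \<Phi> off U(1) V(3) by blast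
    ultimately show ?thesis by blast
  qed
  then have "minimal_cusco \<subseteq> mc_space \<A> closure_of ?D"
    unfolding subset_iff in_closure_of topspace_mc_space[OF \<A>(1)] by blast
  then show ?thesis
    using closure_of_subset_topspace[of "mc_space \<A>" ?D]
    by (auto simp: dense_sets_def topspace_mc_space[OF \<A>(1)])
qed


section \<open>Translating between covers and function spaces\<close>

text \<open>In inning \<open>n\<close> a map is read as the set of points where it is closer than \<open>1 / (n + 1)\<close> to
  zero. Passing to smaller proper open sets costs nothing, and avoids a case distinction for
  maps that are uniformly small on the whole space. As every member of \<open>\<B>\<close> is contained in
  cover elements from arbitrarily late innings, the bounds tend to zero there.\<close>

lemma clustering_game_no_harder_than_cover_game:
  fixes \<A> \<B> :: "'a::t1_space set set"
  assumes \<A>: "closed_ideal \<A>" and \<B>: "closed_ideal \<B>"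
  shows "no_harder_for_two
    (G1 (clustering_sets (mc_space \<A>) zero_map) (clustering_sets (mc_space \<B>) zero_map))
    (G1 (ideal_covers \<A>) (ideal_covers \<B>))"
proof -
  define small where "small n \<Phi> = {x. \<Phi> x \<subseteq> ball 0 (inverse (real (Suc n)))}"
    for n and \<Phi> :: "'a \<Rightarrow> real set"
  define TI where
    "TI n F = {U. open U \<and> U \<noteq> {} \<and> U \<noteq> UNIV \<and> (\<exists>\<Phi>\<in>F. U \<subseteq> small n \<Phi>)}" for n F
  define TII where "TII n F U = (SOME \<Phi>. \<Phi> \<in> F \<and> U \<subseteq> small n \<Phi>)" for n F U
  have TII: "TII n F U \<in> F \<and> U \<subseteq> small n (TII n F U)" if "U \<in> TI n F" for n F U
  proof -
    have "\<exists>\<Phi>. \<Phi> \<in> F \<and> U \<subseteq> small n \<Phi>" using that by (auto simp: TI_def)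
    from someI_ex[OF this] show ?thesis unfolding TII_def .
  qed
  show ?thesis
  proof (rule no_harder_for_two_by_translation[where TI = TI and TII = TII]; simp)
    fix n F assume F: "F \<in> clustering_sets (mc_space \<A>) zero_map"
    show "TI n F \<in> ideal_covers \<A>"
    proof (rule ideal_coversI[OF \<A>])
      fix A assume A: "A \<in> \<A>"
      obtain \<Phi> where \<Phi>: "\<Phi> \<in> F" "\<forall>x\<in>A. \<Phi> x \<subseteq> ball 0 (inverse (real (Suc n)))"
        using F A inverse_positive_iff_positive[of "real (Suc n)"]
        unfolding clustering_zero_iff[OF \<A>] by (meson of_nat_0_less_iff zero_less_Suc)
      then have "cusco \<Phi>" using F by (auto simp: clustering_zero_iff[OF \<A>] minimal_cusco_def)
      then have "open (small n \<Phi>)" by (simp add: cusco_def small_def)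
      moreover obtain y where "y \<notin> A" using closed_idealD(2)[OF \<A> A] by blast
      moreover have "A \<subseteq> small n \<Phi>" using \<Phi>(2) by (auto simp: small_def)
      moreover have "A \<noteq> {}" using closed_idealD(1)[OF \<A> A] .
      ultimately show "\<exists>U\<in>TI n F. A \<subseteq> U"
        using \<Phi>(1) by (intro bexI[of _ "small n \<Phi> - {y}"]) (auto simp: TI_def)
    qed (auto simp: TI_def)
    show "TII n F U \<in> F" if "U \<in> TI n F" for U using TII[OF that] by blast
  next
    fix F U
    assume F: "\<And>n. F n \<in> clustering_sets (mc_space \<A>) zero_map"
      and U: "\<And>n. U n \<in> TI n (F n)" and cover: "range U \<in> ideal_covers \<B>"
    have "\<exists>n. \<forall>x\<in>B. TII n (F n) (U n) x \<subseteq> ball 0 \<epsilon>" if B: "B \<in> \<B>" and "\<epsilon> > 0" for B \<epsilon>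
    proof -
      obtain N where N: "inverse (real (Suc N)) < \<epsilon>" using reals_Archimedean[OF \<open>\<epsilon> > 0\<close>] by blast
      obtain n where n: "n \<ge> N" "B \<subseteq> U n"
        by (rule ideal_cover_late_member[OF \<B> cover B])
      have "inverse (real (Suc n)) \<le> inverse (real (Suc N))" using n(1) by simp
      then have "ball 0 (inverse (real (Suc n))) \<subseteq> ball (0::real) \<epsilon>"
        using N by (intro subset_ball) linarith
      then show ?thesis using TII[OF U, of n] n(2) unfolding small_def by blast
    qed
    moreover have "TII n (F n) (U n) \<in> minimal_cusco" for n
      using F[of n] TII[OF U, of n] by (auto simp: clustering_zero_iff[OF \<A>])
    ultimately show "range (\<lambda>n. TII n (F n) (U n)) \<in> clustering_sets (mc_space \<B>) zero_map"
      by (auto simp: clustering_zero_iff[OF \<B>])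
  qed
qed

text \<open>A cover becomes the dense set of the maps that are constantly one off some member of it. Where
  such a map is close to zero, that member of the cover must contain the point.\<close>

lemma cover_game_no_harder_than_dense_game:
  fixes \<A> \<B> :: "'a::topological_space set set"
  assumes \<A>: "closed_ideal \<A>" "ideal_normal \<A>" and \<B>: "closed_ideal \<B>"
  shows "no_harder_for_two (G1 (ideal_covers \<A>) (ideal_covers \<B>))
    (G1 (dense_sets (mc_space \<A>)) (clustering_sets (mc_space \<B>) zero_map))"
proof -
  define TI where "TI n \<U> = {\<Phi> \<in> minimal_cusco. \<exists>U\<in>\<U>. \<forall>x. x \<notin> U \<longrightarrow> \<Phi> x = {1::real}}"
    for n :: nat and \<U> :: "'a set set"
  define TII where "TII n \<U> \<Phi> = (SOME U. U \<in> \<U> \<and> (\<forall>x. x \<notin> U \<longrightarrow> \<Phi> x = {1::real}))"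
    for n :: nat and \<U> :: "'a set set" and \<Phi>
  have TII: "TII n \<U> \<Phi> \<in> \<U> \<and> (\<forall>x. x \<notin> TII n \<U> \<Phi> \<longrightarrow> \<Phi> x = {1})" if "\<Phi> \<in> TI n \<U>" for n \<U> \<Phi>
  proof -
    have "\<exists>U. U \<in> \<U> \<and> (\<forall>x. x \<notin> U \<longrightarrow> \<Phi> x = {1})" using that by (auto simp: TI_def)
    from someI_ex[OF this] show ?thesis unfolding TII_def .
  qed
  show ?thesis
  proof (rule no_harder_for_two_by_translation[where TI = TI and TII = TII]; simp)
    show "TI n \<U> \<in> dense_sets (mc_space \<A>)" if "\<U> \<in> ideal_covers \<A>" for n \<U>
      unfolding TI_def by (rule dense_constant_off_cover[OF \<A> that])
    show "TII n \<U> \<Phi> \<in> \<U>" if "\<Phi> \<in> TI n \<U>" for n \<U> \<Phi> using TII[OF that] by blast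
  next
    fix \<U> \<Phi>
    assume \<U>: "\<And>n. \<U> n \<in> ideal_covers \<A>" and \<Phi>: "\<And>n. \<Phi> n \<in> TI n (\<U> n)"
      and cl: "range \<Phi> \<in> clustering_sets (mc_space \<B>) zero_map"
    show "range (\<lambda>n. TII n (\<U> n) (\<Phi> n)) \<in> ideal_covers \<B>"
    proof (rule ideal_coversI[OF \<B>])
      fix B assume "B \<in> \<B>"
      then obtain n where "\<forall>x\<in>B. \<Phi> n x \<subseteq> ball 0 1"
        using cl zero_less_one unfolding clustering_zero_iff[OF \<B>] by blast
      then have "B \<subseteq> TII n (\<U> n) (\<Phi> n)" using TII[OF \<Phi>, of n] by fastforce
      then show "\<exists>U\<in>range (\<lambda>n. TII n (\<U> n) (\<Phi> n)). B \<subseteq> U" by blast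
    next
      fix U assume "U \<in> range (\<lambda>n. TII n (\<U> n) (\<Phi> n))"
      then obtain n where "U \<in> \<U> n" using TII[OF \<Phi>] by blast
      then show "open U \<and> U \<noteq> {} \<and> U \<noteq> UNIV" using \<U>[of n] by (auto simp: ideal_covers_def)
    qed
  qed
qed


section \<open>Equivalence and duality of the cover and function space games\<close>
theorem corollary33:
  fixes \<A> \<B> :: "'a::t2_space set set"
  assumes "closed_ideal \<A>" and "closed_ideal \<B>" and "ideal_normal \<A>"
  shows
    "equivalent_games
       (G1 (ideal_covers \<A>) (ideal_covers \<B>))
       (G1 (clustering_sets (mc_space \<A>) zero_map) (clustering_sets (mc_space \<B>) zero_map)) \<and>
     equivalent_games
       (G1 (clustering_sets (mc_space \<A>) zero_map) (clustering_sets (mc_space \<B>) zero_map))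
       (G1 (dense_sets (mc_space \<A>)) (clustering_sets (mc_space \<B>) zero_map)) \<and>
     equivalent_games
       (G1 (set_nbhds (euclidean :: 'a topology) ` \<A>) (- ideal_covers \<B>))
       (G1 (point_nbhds (mc_space \<A>) zero_map) (- clustering_sets (mc_space \<B>) zero_map)) \<and>
     equivalent_games
       (G1 (point_nbhds (mc_space \<A>) zero_map) (- clustering_sets (mc_space \<B>) zero_map))
       (G1 (proper_opens (mc_space \<A>)) (- clustering_sets (mc_space \<B>) zero_map)) \<and>
     dual_games
       (G1 (ideal_covers \<A>) (ideal_covers \<B>))
       (G1 (set_nbhds (euclidean :: 'a topology) ` \<A>) (- ideal_covers \<B>))"
proof (intro conjI)
  let ?Y = "mc_space \<A>" and ?D = "clustering_sets (mc_space \<B>) zero_map"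
  let ?G1 = "G1 (ideal_covers \<A>) (ideal_covers \<B>)"
    and ?G2 = "G1 (clustering_sets ?Y zero_map) ?D" and ?G3 = "G1 (dense_sets ?Y) ?D"
  have "dense_sets ?Y \<subseteq> clustering_sets ?Y zero_map"
    using zero_map_minimal_cusco
    by (auto simp: dense_sets_def clustering_sets_def topspace_mc_space[OF assms(1)])
  then have cycle: "no_harder_for_two ?G2 ?G1" "no_harder_for_two ?G3 ?G2" "no_harder_for_two ?G1 ?G3"
    using clustering_game_no_harder_than_cover_game[OF assms(1,2)]
      cover_game_no_harder_than_dense_game[OF assms(1,3,2)]
    by (auto intro: no_harder_for_two_if_fewer_moves)
  show eq12: "equivalent_games ?G1 ?G2" and eq23: "equivalent_games ?G2 ?G3"
    using equivalent_games_if_cycle[OF cycle] by blast+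
  have nbhds: "point_nbhds ?Y zero_map \<noteq> {}" by (rule point_nbhds_zero_nonempty[OF assms(1)])
  then have opens: "proper_opens ?Y \<noteq> {}" by (auto simp: point_nbhds_def)
  show dual1: "dual_games ?G1
      (G1 (set_nbhds (euclidean :: 'a topology) ` \<A>) (- ideal_covers \<B>))"
    by (intro dual_games_if_dual_families dual_families_covers assms(1))
  have dual2: "dual_games ?G2 (G1 (point_nbhds ?Y zero_map) (- ?D))"
    by (intro dual_games_if_dual_families dual_families_clustering nbhds)
  have dual3: "dual_games ?G3 (G1 (proper_opens ?Y) (- ?D))"
    by (intro dual_games_if_dual_families dual_families_dense opens)
  show "equivalent_games (G1 (set_nbhds (euclidean :: 'a topology) ` \<A>) (- ideal_covers \<B>))
      (G1 (point_nbhds ?Y zero_map) (- ?D))"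
    by (rule equivalent_games_duals[OF eq12 dual1 dual2])
  show "equivalent_games (G1 (point_nbhds ?Y zero_map) (- ?D)) (G1 (proper_opens ?Y) (- ?D))"
    by (rule equivalent_games_duals[OF eq23 dual2 dual3])
qed

end
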